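(* Let $(\{1,2\},A_1,A_2,u_1,u_2)$ be a two-player finite strategic game with noncooperative payoff region $S_{\mathrm{nc}}\subset\mathbb{R}^2$. Suppose that $\{(v_1^t,v_2^t)\}_{t\in\mathbb{N}}$ is a sequence in $S_{\mathrm{nc}}$ which converges to a point $(v_1^*,v_2^* )\in S_{\mathrm{nc}}$ and satisfies $v_1^t>v_1^*$ and $v_2^*>v_2^t$ for all $t$. If $$\lim_{t\to\infty}\frac{v_2^t-v_2^*}{v_1^t-v_1^*}=0,$$ then $(v_1^*,v_2^* )\notin P(S_{\mathrm{nc}})$, where $P(S_{\mathrm{nc}})$ is the Pareto frontier of $S_{\mathrm{nc}}$.
   Context: A two-player finite strategic game $(\{1,2\},A_1,A_2,u_1,u_2)$ consists of nonempty finite sets $A_1,A_2$ of pure strategies and payoff functions $u_1,u_2\colon A_1\times A_2\to\mathbb{R}$; put $u=(u_1,u_2)$. $\Delta(A_i)$ is the set of probability distributions on $A_i$. For $(\sigma_1,\sigma_2)\in\Delta(A_1)\times\Delta(A_2)$ set $u(\sigma_1,\sigma_2)=\sum_{a_1\in A_1}\sum_{a_2\in A_2}\sigma_1(a_1)\sigma_2(a_2)\,u(a_1,a_2)\in\mathbb{R}^2$. The noncooperative payoff region is $S_{\mathrm{nc}}=u(\Delta(A_1)\times\Delta(A_2))$. A point $w\in\mathbb{R}^n$ Pareto dominates $v\in\mathbb{R}^n$ if $w\ne v$ and $w_i\ge v_i$ for all $i=1,\dots,n$. The Pareto frontier $P(S)$ of a nonempty set $S\subseteq\mathbb{R}^n$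 is the set of $v\in S$ such that no $w\in S$ Pareto dominates $v$. *)

theory Defs
  imports "HOL-Probability.Probability"
begin

definition mixed_strategies :: "'a set \<Rightarrow> 'a pmf set" where
  "mixed_strategies A = {p. set_pmf p \<subseteq> A}"

definition payoff_vector ::
  "('a \<times> 'b \<Rightarrow> real) \<Rightarrow> ('a \<times> 'b \<Rightarrow> real) \<Rightarrow> 'a \<times> 'b \<Rightarrow> real ^ 2" where
  "payoff_vector u1 u2 a = vector [u1 a, u2 a]"

definition expected_payoff ::
  "'a set \<Rightarrow> 'b set \<Rightarrow> ('a \<times> 'b \<Rightarrow> real ^ 2) \<Rightarrow> 'a pmf \<Rightarrow> 'b pmf \<Rightarrow> real ^ 2" where
  "expected_payoff A1 A2 u \<sigma>1 \<sigma>2 =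
     (\<Sum>a1\<in>A1. \<Sum>a2\<in>A2. (pmf \<sigma>1 a1 * pmf \<sigma>2 a2) *\<^sub>R u (a1, a2))"

text \<open>The mixed strategies of the two players are independent, so this is the image of a product
  and in general not convex.\<close>

definition noncoop_payoff_region ::
  "'a set \<Rightarrow> 'b set \<Rightarrow> ('a \<times> 'b \<Rightarrow> real) \<Rightarrow> ('a \<times> 'b \<Rightarrow> real) \<Rightarrow> (real ^ 2) set" where
  "noncoop_payoff_region A1 A2 u1 u2 =
     (\<lambda>(\<sigma>1, \<sigma>2). expected_payoff A1 A2 (payoff_vector u1 u2) \<sigma>1 \<sigma>2) `
       (mixed_strategies A1 \<times> mixed_strategies A2)"

definition pareto_dominates :: "real ^ 'n \<Rightarrow> real ^ 'n \<Rightarrow> bool" where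
  "pareto_dominates w v \<longleftrightarrow> w \<noteq> v \<and> (\<forall>i. w $ i \<ge> v $ i)"

definition pareto_frontier :: "(real ^ 'n) set \<Rightarrow> (real ^ 'n) set" where
  "pareto_frontier S = {v \<in> S. \<not> (\<exists>w\<in>S. pareto_dominates w v)}"

end

(* A Pareto optimal point of a bilinear 2 x 2 game is, near each of its realizing strategy pairs,
   certified by a linear functional k * v1 + v2 with k > 0 on the part where v1 increases; hence
   the slope there is at most - k.  The general case reduces to finitely many 2 x 2 games:
   fixing one player's strategy, any convex combination of payoff points in the plane is weakly
   dominated by a combination of two of them, so every v t is weakly dominated by a payoff of a
   2 x 2 subgame.  Infinitely many t share a subgame; by compactness their strategies cluster, and
   the payoff at the limit weakly dominates vstar, hence equals vstar if vstar is Pareto optimal. *)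

theory Submission
  imports Defs
begin

section \<open>Signs of bilinear functions near a corner\<close>

text \<open>Near the origin a negative linear coefficient absorbs the bilinear term, for instance
  \<open>(a + c * y) * x \<le> 0\<close> for small \<open>y\<close>. The only sign pattern excluded
  by the last hypothesis is \<open>a = b = 0\<close> with \<open>c > 0\<close>.\<close>

lemma bilinear_nonpos_near_0:
  fixes a b c :: real
  assumes "a \<le> 0" "b \<le> 0" "a < 0 \<or> b < 0 \<or> c \<le> 0"
  obtains d where "d > 0"
    "\<And>x y. \<lbrakk>0 \<le> x; x \<le> d; 0 \<le> y; y \<le> d\<rbrakk> \<Longrightarrow> a * x + b * y + c * x * y \<le> 0"
proof -
  consider "a < 0" | "b < 0" | "c \<le> 0" using assms(3) by blast
  then show thesis
  proof cases
    case 1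
    \<comment> \<open>Chosen so that \<open>c * y \<le> - a\<close> for \<open>y \<le> d\<close>;
      the summand 1 keeps the denominator positive when \<open>c = 0\<close>.\<close>
    define d where "d = - a / (\<bar>c\<bar> + 1)"
    have "d > 0" using 1 by (auto simp: d_def divide_neg_pos)
    moreover have "a * x + b * y + c * x * y \<le> 0"
      if "0 \<le> x" "x \<le> d" "0 \<le> y" "y \<le> d" for x y
    proof -
      have "c * y \<le> (\<bar>c\<bar> + 1) * d" using that by (intro mult_mono) auto
      also have "\<dots> = - a" by (simp add: d_def)
      finally have "(a + c * y) * x \<le> 0" using that by (intro mult_nonpos_nonneg) auto
      moreover have "b * y \<le> 0" using assms that by (intro mult_nonpos_nonneg) auto
      ultimately show ?thesis by (simp add: algebra_simps)
    qed
    ultimately show thesis by (rule that)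
  next
    case 2
    define d where "d = - b / (\<bar>c\<bar> + 1)"
    have "d > 0" using 2 by (auto simp: d_def divide_neg_pos)
    moreover have "a * x + b * y + c * x * y \<le> 0"
      if "0 \<le> x" "x \<le> d" "0 \<le> y" "y \<le> d" for x y
    proof -
      have "c * x \<le> (\<bar>c\<bar> + 1) * d" using that by (intro mult_mono) auto
      also have "\<dots> = - b" by (simp add: d_def)
      finally have "(b + c * x) * y \<le> 0" using that by (intro mult_nonpos_nonneg) auto
      moreover have "a * x \<le> 0" using assms that by (intro mult_nonpos_nonneg) auto
      ultimately show ?thesis by (simp add: algebra_simps)
    qed
    ultimately show thesis by (rule that)
  next
    case 3
    have "a * x + b * y + c * x * y \<le> 0" if "0 \<le> x" "x \<le> 1" "0 \<le> y" "y \<le> 1" for x y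
    proof -
      have "a * x \<le> 0" "b * y \<le> 0" "c * (x * y) \<le> 0"
        using assms 3 that by (auto intro!: mult_nonpos_nonneg)
      then show ?thesis by (simp add: algebra_simps)
    qed
    then show thesis using that[of 1] by simp
  qed
qed

text \<open>The improving point solves \<open>a1 * x + b1 * y + c1 * x * y = 0\<close> for \<open>x\<close>; the second
  coordinate is then the combination with weight \<open>k = - a2 / a1\<close>, which has no \<open>x\<close> term.\<close>

lemma bilinear_improvement:
  fixes a1 a2 b1 b2 c1 c2 :: real
  assumes "a1 > 0" "b1 < 0"
    and k: "k * a1 + a2 = 0" "k * b1 + b2 \<ge> 0" "k * b1 + b2 > 0 \<or> k * c1 + c2 > 0"
  obtains x y where "0 \<le> x" "x \<le> 1" "0 \<le> y" "y \<le> 1"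
    "a1 * x + b1 * y + c1 * x * y = 0" "a2 * x + b2 * y + c2 * x * y > 0"
proof -
  define B C where "B = k * b1 + b2" and "C = k * c1 + c2"
  define X where "X = (\<lambda>y. - b1 * y / (a1 + c1 * y))"
  have "(\<lambda>y. a1 + c1 * y) \<midarrow>0\<rightarrow> a1" by (auto intro!: tendsto_eq_intros)
  then have e1: "eventually (\<lambda>y. a1 + c1 * y > 0) (at_right 0)"
    using assms(1) by (auto intro: order_tendstoD filterlim_at_split[THEN iffD1, THEN conjunct2])
  have X0: "(X \<longlongrightarrow> 0) (at_right 0)"
    unfolding X_def using assms(1) by (auto intro!: tendsto_eq_intros)
  have e2: "eventually (\<lambda>y. X y < 1) (at_right 0)" using X0 by (rule order_tendstoD) simp
  \<comment> \<open>If \<open>B > 0\<close>, positivity survives because \<open>X y\<close> tends to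
    0. If \<open>B = 0\<close>, it has to come from \<open>C > 0\<close> and \<open>X y > 0\<close>,
    which is settled once \<open>y\<close> is fixed.\<close>
  have e3: "eventually (\<lambda>y. B = 0 \<or> B + C * X y > 0) (at_right 0)"
  proof (cases "B = 0")
    case False
    then have "B > 0" using k(2) by (simp add: B_def)
    moreover have "((\<lambda>y. B + C * X y) \<longlongrightarrow> B) (at_right 0)"
      using X0 by (auto intro!: tendsto_eq_intros)
    ultimately have "eventually (\<lambda>y. B + C * X y > 0) (at_right 0)"
      by (intro order_tendstoD)
    then show ?thesis by eventually_elim simp
  qed simp
  have e4: "eventually (\<lambda>y::real. 0 < y \<and> y < 1) (at_right 0)"
    using eventually_at_right_real[of 0 1] by (simp add: eventually_at_right_less)
  have "eventually (\<lambda>y. a1 + c1 * y > 0 \<and> X y < 1 \<and> (B = 0 \<or> B + C * X y > 0) \<and> 0 < y \<and> y < 1)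
      (at_right 0)"
    using e1 e2 e3 e4 by eventually_elim simp
  then obtain y where y: "a1 + c1 * y > 0" "X y < 1" "B = 0 \<or> B + C * X y > 0" "0 < y" "y < 1"
    using eventually_happens'[OF trivial_limit_at_right_real] by blast
  have X: "X y > 0" using y assms(2) by (auto simp: X_def intro!: divide_neg_pos mult_neg_pos)
  have z: "a1 * X y + b1 * y + c1 * X y * y = 0"
  proof -
    have "X y * (a1 + c1 * y) = - b1 * y" using y by (simp add: X_def)
    then show ?thesis by (simp add: algebra_simps)
  qed
  have "B + C * X y > 0"
    using y(3) k(3) X by (auto simp: B_def C_def)
  then have "0 < y * (B + C * X y)" using y by simp
  also have "\<dots> = k * (a1 * X y + b1 * y + c1 * X y * y) + (a2 * X y + b2 * y + c2 * X y * y)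
      - (k * a1 + a2) * X y"
    by (simp add: B_def C_def algebra_simps)
  also have "\<dots> = a2 * X y + b2 * y + c2 * X y * y" using z k(1) by simp
  finally show thesis using that[of "X y" y] X y z by simp
qed

text \<open>Each axis constrains \<open>k\<close>: since \<open>a1 > 0\<close> forces
  \<open>a2 < 0\<close>, the first axis demands \<open>k \<le> - a2 / a1\<close>. The second axis
  gives a competing lower bound only if \<open>b1 < 0 < b2\<close>. When the two bounds leave no
  interior room, either \<open>bilinear_improvement\<close> contradicts optimality or
  \<open>k = - a2 / a1\<close> kills both linear terms and leaves a nonpositive bilinear
  one.\<close>

lemma bilinear_pareto_weight:
  fixes a1 a2 b1 b2 c1 c2 :: real
  assumes pareto: "\<And>x y. \<lbrakk>0 \<le> x; x \<le> 1; 0 \<le> y; y \<le> 1;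
      0 \<le> a1 * x + b1 * y + c1 * x * y; 0 \<le> a2 * x + b2 * y + c2 * x * y\<rbrakk>
    \<Longrightarrow> a1 * x + b1 * y + c1 * x * y = 0 \<and> a2 * x + b2 * y + c2 * x * y = 0"
    and "a1 > 0"
  obtains k where "k > 0" "k * a1 + a2 \<le> 0" "k * b1 + b2 \<le> 0"
    "k * a1 + a2 < 0 \<or> k * b1 + b2 < 0 \<or> k * c1 + c2 \<le> 0"
proof -
  have a2: "a2 < 0" using pareto[of 1 0] \<open>a1 > 0\<close> by force
  have b: "b1 \<ge> 0 \<Longrightarrow> b2 \<ge> 0 \<Longrightarrow> b1 = 0 \<and> b2 = 0" using pareto[of 0 1] by simp
  define K where "K = - a2 / a1"
  have K: "K > 0" "K * a1 + a2 = 0" using a2 \<open>a1 > 0\<close> by (auto simp: K_def divide_neg_pos)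
  \<comment> \<open>Any \<open>k\<close> strictly below \<open>K\<close> already fulfils the last
    conclusion, whatever \<open>c1\<close> and \<open>c2\<close> are.\<close>
  have small: "k * a1 + a2 < 0" if "k < K" for k
    using mult_strict_right_mono[OF that \<open>a1 > 0\<close>] K by linarith
  consider "b1 \<le> 0" "b2 \<le> 0" | "b1 > 0" "b2 < 0" | "b1 < 0" "b2 > 0"
    using b by linarith
  then show thesis
  proof cases
    case 1
    have "K / 2 * b1 \<le> 0" using 1 K by (intro mult_nonneg_nonpos) auto
    then show thesis using that[of "K / 2"] small[of "K / 2"] K 1 by simp
  next
    case 2
    define k where "k = min (K / 2) (- b2 / b1)"
    have "k > 0" using K 2 by (auto simp: k_def divide_neg_pos)
    moreover have "k < K" using K(1) min.cobounded1[of "K / 2" "- b2 / b1"] unfolding k_def by linarith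
    moreover have "k * b1 \<le> - b2 / b1 * b1" using 2 by (intro mult_right_mono) (auto simp: k_def)
    ultimately show thesis using that[of k] small[of k] 2 by simp
  next
    case 3
    show thesis
    proof (cases "K * b1 + b2 < 0")
      case True
      \<comment> \<open>The midpoint between the lower bound \<open>- b2 / b1\<close> from the
        second axis and the upper bound \<open>K\<close> from the first.\<close>
      define k where "k = (K - b2 / b1) / 2"
      have "b2 / b1 < 0" using 3 by (simp add: divide_pos_neg)
      moreover have "- b2 / b1 < K" using True 3 by (simp add: field_simps)
      ultimately have "k > 0" "k < K" using K by (auto simp: k_def)
      moreover have "k * b1 + b2 = (K * b1 + b2) / 2" using 3 by (simp add: k_def field_simps)
      then have "k * b1 + b2 \<le> 0" using True by simp
      ultimately show thesis using that[of k] small[of k] by simp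
    next
      case False
      show thesis
      \<comment> \<open>Here \<open>K * b1 + b2 \<ge> 0\<close>, so the first case is exactly the
        situation of \<open>bilinear_improvement\<close>; in the second, both linear coefficients
        vanish at \<open>K\<close>.\<close>
      proof (cases "K * b1 + b2 > 0 \<or> K * c1 + c2 > 0")
        case True
        obtain x y where "0 \<le> x" "x \<le> 1" "0 \<le> y" "y \<le> 1"
          "a1 * x + b1 * y + c1 * x * y = 0" "a2 * x + b2 * y + c2 * x * y > 0"
          using bilinear_improvement[OF \<open>a1 > 0\<close> 3(1) K(2) _ True] False by (metis not_less)
        then show thesis using pareto[of x y] by simp
      next
        case F: False
        then show thesis using that[of K] K by simp
      qed
    qed
  qed
qed

text \<open>A positive first-coordinate slope on either axis is covered by
  \<open>bilinear_pareto_weight\<close>, after swapping the axes if needed. Otherwise the first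
  coordinate does not increase to first order, and a large \<open>k\<close> makes its decrease
  prevail. If \<open>a1 = b1 = 0\<close>, the signs of \<open>a2\<close>, \<open>b2\<close> and the
  test point \<open>(1, 1)\<close> decide.\<close>

lemma bilinear_pareto_multiplier:
  fixes a1 a2 b1 b2 c1 c2 :: real
  assumes pareto: "\<And>x y. \<lbrakk>0 \<le> x; x \<le> 1; 0 \<le> y; y \<le> 1;
      0 \<le> a1 * x + b1 * y + c1 * x * y; 0 \<le> a2 * x + b2 * y + c2 * x * y\<rbrakk>
    \<Longrightarrow> a1 * x + b1 * y + c1 * x * y = 0 \<and> a2 * x + b2 * y + c2 * x * y = 0"
  obtains k d where "k > 0" "d > 0"
    "\<And>x y. \<lbrakk>0 \<le> x; x \<le> d; 0 \<le> y; y \<le> d\<rbrakk>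
      \<Longrightarrow> k * (a1 * x + b1 * y + c1 * x * y) + (a2 * x + b2 * y + c2 * x * y) \<le> 0"
proof -
  have large: "\<exists>k>0. k * s + t < 0" if "s < 0" for s t :: real
  proof -
    define k where "k = (\<bar>t\<bar> + 1) / (- s)"
    have "k > 0" "k * s + t = t - (\<bar>t\<bar> + 1)" using that by (auto simp: k_def divide_pos_pos field_simps)
    then show ?thesis by (intro exI[of _ k]) auto
  qed
  have a: "a1 \<ge> 0 \<Longrightarrow> a2 \<ge> 0 \<Longrightarrow> a1 = 0 \<and> a2 = 0" using pareto[of 1 0] by simp
  have b: "b1 \<ge> 0 \<Longrightarrow> b2 \<ge> 0 \<Longrightarrow> b1 = 0 \<and> b2 = 0" using pareto[of 0 1] by simp
  \<comment> \<open>As \<open>s1\<close> and \<open>t1\<close> are nonpositive, increasing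
    \<open>k\<close> preserves both inequalities, so the maximum of two separate multipliers serves.
    The last premise covers \<open>t1 = 0\<close>, where \<open>k\<close> has no influence.\<close>
  have two: "\<exists>k>0. k * s1 + s2 < 0 \<and> k * t1 + t2 \<le> 0"
    if st: "s1 < 0" "t1 \<le> 0" "t1 \<ge> 0 \<Longrightarrow> t2 \<le> 0" for s1 s2 t1 t2 :: real
  proof -
    obtain k where k: "k > 0" "k * s1 + s2 < 0" using large[OF st(1)] by blast
    obtain l where l: "l > 0" "l * t1 + t2 \<le> 0"
    proof (cases "t1 < 0")
      case True
      then show thesis using large[of t1 t2] that less_imp_le by blast
    next
      case False
      then show thesis using st that[of 1] by simp
    qed
    have "max k l * s1 \<le> k * s1" "max k l * t1 \<le> l * t1"
      using st by (simp_all add: mult_right_mono_neg)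
    then show ?thesis using k l by (intro exI[of _ "max k l"]) auto
  qed
  have "\<exists>k>0. k * a1 + a2 \<le> 0 \<and> k * b1 + b2 \<le> 0 \<and>
    (k * a1 + a2 < 0 \<or> k * b1 + b2 < 0 \<or> k * c1 + c2 \<le> 0)"
  proof -
    consider "a1 > 0" | "b1 > 0" | "a1 < 0" "b1 \<le> 0" | "a1 \<le> 0" "b1 < 0" | "a1 = 0" "b1 = 0"
      by linarith
    then show ?thesis
    proof cases
      case 1
      obtain k where "k > 0" "k * a1 + a2 \<le> 0" "k * b1 + b2 \<le> 0"
        "k * a1 + a2 < 0 \<or> k * b1 + b2 < 0 \<or> k * c1 + c2 \<le> 0"
        by (rule bilinear_pareto_weight[of a1 b1 c1 a2 b2 c2]) (use pareto 1 in auto)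
      then show ?thesis by (intro exI[of _ k] conjI)
    next
      case 2
      have "b1 * x + a1 * y + c1 * x * y = 0 \<and> b2 * x + a2 * y + c2 * x * y = 0"
        if "0 \<le> x" "x \<le> 1" "0 \<le> y" "y \<le> 1"
          "0 \<le> b1 * x + a1 * y + c1 * x * y" "0 \<le> b2 * x + a2 * y + c2 * x * y" for x y
        using pareto[of y x] that by (simp add: algebra_simps)
      then obtain k where "k > 0" "k * b1 + b2 \<le> 0" "k * a1 + a2 \<le> 0"
        "k * b1 + b2 < 0 \<or> k * a1 + a2 < 0 \<or> k * c1 + c2 \<le> 0"
        by (rule bilinear_pareto_weight[of b1 a1 c1 b2 a2 c2]) (use 2 in auto)
      then show ?thesis by (intro exI[of _ k] conjI) auto
    next
      case 3
      then obtain k where "k > 0" "k * a1 + a2 < 0" "k * b1 + b2 \<le> 0"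
        using two[of a1 b1 b2 a2] b by (metis linorder_linear order_refl)
      then show ?thesis by (intro exI[of _ k]) auto
    next
      case 4
      then obtain k where "k > 0" "k * b1 + b2 < 0" "k * a1 + a2 \<le> 0"
        using two[of b1 a1 a2 b2] a by (metis linorder_linear order_refl)
      then show ?thesis by (intro exI[of _ k]) auto
    next
      case 5
      then have ab: "a2 \<le> 0" "b2 \<le> 0" using a b by force+
      \<comment> \<open>With all linear terms gone, the increment at \<open>(1, 1)\<close> is
        \<open>(c1, c2)\<close>.\<close>
      have c: "c1 \<ge> 0 \<Longrightarrow> c2 \<ge> 0 \<Longrightarrow> c1 = 0 \<and> c2 = 0" if "a2 = 0" "b2 = 0"
        using pareto[of 1 1] 5 that by simp
      consider "a2 < 0 \<or> b2 < 0" | "a2 = 0" "b2 = 0" "c1 < 0" | "a2 = 0" "b2 = 0" "c1 = 0" "c2 \<le> 0"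
        | "a2 = 0" "b2 = 0" "c1 > 0" "c2 < 0"
        using ab c by linarith
      then show ?thesis
      proof cases
        case 1 then show ?thesis using 5 ab by (intro exI[of _ 1]) auto
      next
        case 2
        then obtain k where "k > 0" "k * c1 + c2 < 0" using large by blast
        then show ?thesis using 2 5 by (intro exI[of _ k]) auto
      next
        case 3 then show ?thesis using 5 by (intro exI[of _ 1]) auto
      next
        case 4 then show ?thesis using 5 by (intro exI[of _ "- c2 / c1"]) (auto simp: divide_neg_pos)
      qed
    qed
  qed
  then obtain k where k: "k > 0" "k * a1 + a2 \<le> 0" "k * b1 + b2 \<le> 0"
    "k * a1 + a2 < 0 \<or> k * b1 + b2 < 0 \<or> k * c1 + c2 \<le> 0" by blast
  obtain d where d: "d > 0" "\<And>x y. \<lbrakk>0 \<le> x; x \<le> d; 0 \<le> y; y \<le> d\<rbrakk> \<Longrightarrow>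
      (k * a1 + a2) * x + (k * b1 + b2) * y + (k * c1 + c2) * x * y \<le> 0"
    using bilinear_nonpos_near_0[OF k(2-4)] by blast
  show thesis
  proof (rule that[OF k(1) d(1)])
    show "k * (a1 * x + b1 * y + c1 * x * y) + (a2 * x + b2 * y + c2 * x * y) \<le> 0"
      if "0 \<le> x" "x \<le> d" "0 \<le> y" "y \<le> d" for x y
      using d(2)[OF that] by (simp add: algebra_simps)
  qed
qed

section \<open>Multipliers at an arbitrary point of the unit square\<close>

text \<open>Moving from \<open>(p, q)\<close> by fractions \<open>x\<close>, \<open>y\<close> of the
  way to \<open>(i, j)\<close> stays in the square, and the increments of \<open>f\<close> and
  \<open>g\<close> are bilinear in \<open>x\<close>, \<open>y\<close> without constant term.
  Optimality at \<open>(p, q)\<close> thus becomes optimality at the origin.\<close>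

lemma bilinear_pareto_multiplier_corner:
  fixes f g :: "real \<Rightarrow> real \<Rightarrow> real"
  assumes f: "\<And>p q. f p q = f0 + f1 * p + f2 * q + f3 * p * q"
    and g: "\<And>p q. g p q = g0 + g1 * p + g2 * q + g3 * p * q"
    and pareto: "\<And>p' q'. \<lbrakk>p' \<in> {0..1}; q' \<in> {0..1}; f p q \<le> f p' q'; g p q \<le> g p' q'\<rbrakk>
      \<Longrightarrow> f p' q' = f p q \<and> g p' q' = g p q"
    and pq: "p \<in> {0..1}" "q \<in> {0..1}" and ij: "i \<in> {0..1}" "j \<in> {0..1}"
  obtains k d where "k > 0" "d > 0"
    "\<And>x y. \<lbrakk>x \<in> {0..d}; y \<in> {0..d}\<rbrakk> \<Longrightarrow>
      k * (f (p + x * (i - p)) (q + y * (j - q)) - f p q)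
        + (g (p + x * (i - p)) (q + y * (j - q)) - g p q) \<le> 0"
proof -
  define a1 b1 c1 where "a1 = (i - p) * (f1 + f3 * q)" and "b1 = (j - q) * (f2 + f3 * p)"
    and "c1 = (i - p) * (j - q) * f3"
  define a2 b2 c2 where "a2 = (i - p) * (g1 + g3 * q)" and "b2 = (j - q) * (g2 + g3 * p)"
    and "c2 = (i - p) * (j - q) * g3"
  have F: "f (p + x * (i - p)) (q + y * (j - q)) - f p q = a1 * x + b1 * y + c1 * x * y" for x y
    by (simp add: f a1_def b1_def c1_def algebra_simps)
  have G: "g (p + x * (i - p)) (q + y * (j - q)) - g p q = a2 * x + b2 * y + c2 * x * y" for x y
    by (simp add: g a2_def b2_def c2_def algebra_simps)
  have seg: "s + x * (t - s) \<in> {0..1}" if "s \<in> {0..1}" "t \<in> {0..1}" "0 \<le> x" "x \<le> 1"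
    for s t x :: real
    using convexD_alt[of "{0..1}" s t x] that by (simp add: algebra_simps)
  have par: "a1 * x + b1 * y + c1 * x * y = 0 \<and> a2 * x + b2 * y + c2 * x * y = 0"
    if "0 \<le> x" "x \<le> 1" "0 \<le> y" "y \<le> 1"
      "0 \<le> a1 * x + b1 * y + c1 * x * y" "0 \<le> a2 * x + b2 * y + c2 * x * y" for x y
    using pareto[OF seg[OF pq(1) ij(1) that(1,2)] seg[OF pq(2) ij(2) that(3,4)]] that(5,6)
    unfolding F[symmetric] G[symmetric] by simp
  obtain k d where "k > 0" "d > 0"
    "\<And>x y. \<lbrakk>0 \<le> x; x \<le> d; 0 \<le> y; y \<le> d\<rbrakk>
      \<Longrightarrow> k * (a1 * x + b1 * y + c1 * x * y) + (a2 * x + b2 * y + c2 * x * y) \<le> 0"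
    using bilinear_pareto_multiplier[OF par] by blast
  then show thesis using that[of k d] unfolding F G by simp
qed

lemma near_point_towards_endpoint:
  fixes p d :: real
  assumes "p \<in> {0..1}" "d > 0"
  obtains e where "e > 0"
    "\<And>p'. \<lbrakk>p' \<in> {0..1}; \<bar>p' - p\<bar> < e\<rbrakk> \<Longrightarrow> \<exists>i\<in>{0,1}. \<exists>x\<in>{0..d}. p' = p + x * (i - p)"
proof
  \<comment> \<open>The fraction travelled is the displacement divided by the distance to the
    endpoint, hence the factor \<open>d\<close>. At an endpoint the zero distance is replaced by 1,
    as no point lies beyond it.\<close>
  define e where "e = d * min (if p < 1 then 1 - p else 1) (if p > 0 then p else 1)"
  show "e > 0" using assms by (auto simp: e_def)
  fix p' assume p': "p' \<in> {0..1}" "\<bar>p' - p\<bar> < e"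
  have e: "p < 1 \<Longrightarrow> e \<le> d * (1 - p)" "p > 0 \<Longrightarrow> e \<le> d * p"
    using assms(2) unfolding e_def by (auto intro!: mult_left_mono)
  consider "p' = p" | "p < p'" | "p' < p" by linarith
  then show "\<exists>i\<in>{0,1}. \<exists>x\<in>{0..d}. p' = p + x * (i - p)"
  proof cases
    case 1
    then show ?thesis using assms(2) by (auto intro: bexI[of _ 0])
  next
    case 2
    then have "p < 1" "p' - p \<le> d * (1 - p)" using p' e by auto
    then show ?thesis using 2 by (intro bexI[of _ 1] bexI[of _ "(p' - p) / (1 - p)"])
      (auto simp: pos_divide_le_eq)
  next
    case 3
    then have "0 < p" "p - p' \<le> d * p" using p' e by auto
    then show ?thesis using 3 by (intro bexI[of _ 0] bexI[of _ "(p - p') / p"])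
      (auto simp: pos_divide_le_eq)
  qed
qed

text \<open>The four corners of the square give four multipliers, whose directions cover a
  neighbourhood of \<open>(p, q)\<close>. Their minimum works for all of them where \<open>f\<close>
  does not decrease, since there a smaller multiplier gives a weaker inequality.\<close>

lemma bilinear_pareto_multiplier_square:
  fixes f g :: "real \<Rightarrow> real \<Rightarrow> real"
  assumes f: "\<And>p q. f p q = f0 + f1 * p + f2 * q + f3 * p * q"
    and g: "\<And>p q. g p q = g0 + g1 * p + g2 * q + g3 * p * q"
    and pareto: "\<And>p' q'. \<lbrakk>p' \<in> {0..1}; q' \<in> {0..1}; f p q \<le> f p' q'; g p q \<le> g p' q'\<rbrakk>
      \<Longrightarrow> f p' q' = f p q \<and> g p' q' = g p q"
    and pq: "p \<in> {0..1}" "q \<in> {0..1}"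
  obtains k e where "k > 0" "e > 0"
    "\<And>p' q'. \<lbrakk>p' \<in> {0..1}; q' \<in> {0..1}; \<bar>p' - p\<bar> < e; \<bar>q' - q\<bar> < e; f p q \<le> f p' q'\<rbrakk>
      \<Longrightarrow> k * (f p' q' - f p q) + (g p' q' - g p q) \<le> 0"
proof -
  define R where "R = (\<lambda>k p' q'. k * (f p' q' - f p q) + (g p' q' - g p q) \<le> 0)"
  have "\<forall>c\<in>{0,1::real}\<times>{0,1::real}. \<exists>k d. k > 0 \<and> d > 0 \<and>
    (\<forall>x\<in>{0..d}. \<forall>y\<in>{0..d}. R k (p + x * (fst c - p)) (q + y * (snd c - q)))"
  proof
    fix c :: "real \<times> real" assume "c \<in> {0,1} \<times> {0,1}"
    then have "fst c \<in> {0..1}" "snd c \<in> {0..1}" by auto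
    then obtain k d where "k > 0" "d > 0" "\<And>x y. \<lbrakk>x \<in> {0..d}; y \<in> {0..d}\<rbrakk> \<Longrightarrow>
        R k (p + x * (fst c - p)) (q + y * (snd c - q))"
      using bilinear_pareto_multiplier_corner[OF f g pareto pq, of "fst c" "snd c"]
      unfolding R_def by blast
    then show "\<exists>k d. k > 0 \<and> d > 0 \<and>
      (\<forall>x\<in>{0..d}. \<forall>y\<in>{0..d}. R k (p + x * (fst c - p)) (q + y * (snd c - q)))"
      by blast
  qed
  then obtain k d where kd': "\<forall>c\<in>{0,1::real}\<times>{0,1::real}. k c > 0 \<and> d c > 0 \<and>
    (\<forall>x\<in>{0..d c}. \<forall>y\<in>{0..d c}. R (k c) (p + x * (fst c - p)) (q + y * (snd c - q)))"
    unfolding bchoice_iff by blast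
  have kd: "k (i,j) > 0 \<and> d (i,j) > 0 \<and>
    (\<forall>x\<in>{0..d (i,j)}. \<forall>y\<in>{0..d (i,j)}. R (k (i,j)) (p + x * (i - p)) (q + y * (j - q)))"
    if "i \<in> {0,1}" "j \<in> {0,1}" for i j
    using kd'[THEN bspec, OF SigmaI[OF that]] unfolding fst_conv snd_conv .
  define C where "C = {0,1::real} \<times> {0,1::real}"
  have C: "finite C" "C \<noteq> {}" by (auto simp: C_def)
  define K D where "K = Min (k ` C)" and "D = Min (d ` C)"
  have "K > 0" "D > 0" using kd C unfolding K_def D_def by (auto simp: C_def)
  have KD: "K \<le> k (i,j)" "D \<le> d (i,j)" if "i \<in> {0,1}" "j \<in> {0,1}" for i j
    using C that unfolding K_def D_def by (auto intro!: Min_le simp: C_def)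
  obtain e1 where e1: "e1 > 0" "\<And>p'. \<lbrakk>p' \<in> {0..1}; \<bar>p' - p\<bar> < e1\<rbrakk> \<Longrightarrow>
      \<exists>i\<in>{0,1}. \<exists>x\<in>{0..D}. p' = p + x * (i - p)"
    using near_point_towards_endpoint[OF pq(1) \<open>D > 0\<close>] by blast
  obtain e2 where e2: "e2 > 0" "\<And>q'. \<lbrakk>q' \<in> {0..1}; \<bar>q' - q\<bar> < e2\<rbrakk> \<Longrightarrow>
      \<exists>j\<in>{0,1}. \<exists>y\<in>{0..D}. q' = q + y * (j - q)"
    using near_point_towards_endpoint[OF pq(2) \<open>D > 0\<close>] by blast
  show thesis
  proof
    show "K > 0" "min e1 e2 > 0" using \<open>K > 0\<close> e1 e2 by auto
    fix p' q' assume H: "p' \<in> {0..1}" "q' \<in> {0..1}" "\<bar>p' - p\<bar> < min e1 e2"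
      "\<bar>q' - q\<bar> < min e1 e2" "f p q \<le> f p' q'"
    have near: "\<bar>p' - p\<bar> < e1" "\<bar>q' - q\<bar> < e2" using H(3,4) by auto
    obtain i x where i: "i \<in> {0,1}" "x \<in> {0..D}" "p' = p + x * (i - p)"
      using e1(2)[OF H(1) near(1)] by blast
    obtain j y where j: "j \<in> {0,1}" "y \<in> {0..D}" "q' = q + y * (j - q)"
      using e2(2)[OF H(2) near(2)] by blast
    have "x \<in> {0..d (i,j)}" "y \<in> {0..d (i,j)}"
      using KD(2)[OF i(1) j(1)] i(2) j(2) by auto
    then have "R (k (i,j)) p' q'"
      using kd[OF i(1) j(1)] unfolding i(3) j(3) by blast
    moreover have "K * (f p' q' - f p q) \<le> k (i,j) * (f p' q' - f p q)"
      using KD[OF i(1) j(1)] H by (intro mult_right_mono) auto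
    ultimately show "K * (f p' q' - f p q) + (g p' q' - g p q) \<le> 0"
      by (simp add: R_def)
  qed
qed

section \<open>Planar convex combinations dominated by two points\<close>

text \<open>On three points, zero sum and orthogonality to \<open>f\<close> are two linear
  conditions and leave a nonzero solution. A nonzero vector with sum zero has entries of both signs,
  so its sign may be chosen to suit \<open>g\<close>.\<close>

lemma exchange_direction:
  fixes f g :: "'b \<Rightarrow> real"
  assumes "finite B" "3 \<le> card B"
  obtains h where "(\<Sum>b\<in>B. h b) = 0" "(\<Sum>b\<in>B. h b * f b) = 0" "(\<Sum>b\<in>B. h b * g b) \<ge> 0"
    "\<exists>b\<in>B. h b < 0"
proof -
  obtain T where "T \<subseteq> B" "card T = 3" by (meson obtain_subset_with_card_n assms(2))
  then obtain x y z where T: "{x, y, z} \<subseteq> B" "x \<noteq> y" "y \<noteq> z" "x \<noteq> z"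
    unfolding card_3_iff by blast
  define eq where "eq \<longleftrightarrow> f x = f y \<and> f y = f z"
  \<comment> \<open>Up to sign the cross product of \<open>(1, 1, 1)\<close> with
    \<open>(f x, f y, f z)\<close>; it vanishes when \<open>f\<close> is constant on the three
    points, and then \<open>(1, -1, 0)\<close> does the job.\<close>
  define r s t where "r = (if eq then 1 else f y - f z)" and "s = (if eq then - 1 else f z - f x)"
    and "t = (if eq then 0 else f x - f y)"
  define h where "h = (\<lambda>b. if b = x then r else if b = y then s else if b = z then t else 0)"
  have h: "(\<Sum>b\<in>B. h b * \<phi> b) = r * \<phi> x + s * \<phi> y + t * \<phi> z" for \<phi>
  proof -
    have "(\<Sum>b\<in>B. h b * \<phi> b) = (\<Sum>b\<in>{x, y, z}. h b * \<phi> b)"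
      using assms(1) T by (intro sum.mono_neutral_right) (auto simp: h_def)
    then show ?thesis using T by (simp add: h_def)
  qed
  have rst: "r + s + t = 0" "r * f x + s * f y + t * f z = 0" "r \<noteq> 0 \<or> s \<noteq> 0"
  proof -
    show "r + s + t = 0" by (cases eq) (simp_all add: r_def s_def t_def)
    show "r * f x + s * f y + t * f z = 0"
    proof (cases eq)
      case True
      then show ?thesis unfolding eq_def by (simp add: r_def s_def t_def eq_def)
    next
      case False
      then show ?thesis by (simp add: r_def s_def t_def algebra_simps)
    qed
    show "r \<noteq> 0 \<or> s \<noteq> 0"
    proof (cases eq)
      case False
      then show ?thesis unfolding r_def s_def by (simp add: eq_def)
    qed (simp add: r_def)
  qed
  have hxyz: "h x = r" "h y = s" "h z = t" using T by (auto simp: h_def)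
  have "r < 0 \<or> s < 0 \<or> t < 0" "- r < 0 \<or> - s < 0 \<or> - t < 0" using rst(1,3) by linarith+
  then have sgn: "\<exists>b\<in>B. h b < 0" "\<exists>b\<in>B. - h b < 0"
    using T(1) unfolding hxyz[symmetric] by blast+
  have sums: "(\<Sum>b\<in>B. h b) = 0" "(\<Sum>b\<in>B. h b * f b) = 0"
    using h[of "\<lambda>_. 1"] h[of f] rst(1,2) by simp_all
  show thesis
  proof (cases "(\<Sum>b\<in>B. h b * g b) \<ge> 0")
    case True
    then show thesis using that[of h] sums sgn by blast
  next
    case False
    then show thesis using that[of "\<lambda>b. - h b"] sums sgn by (simp add: sum_negf)
  qed
qed

text \<open>As long as three points remain, shifting the weights along an exchange direction until one
  of them vanishes removes a point without decreasing either coordinate.\<close>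

lemma convex_combination_le_pair:
  fixes w f g :: "'b \<Rightarrow> real"
  assumes "finite B" "\<And>b. b \<in> B \<Longrightarrow> 0 \<le> w b" "(\<Sum>b\<in>B. w b) = 1"
  shows "\<exists>b\<in>B. \<exists>b'\<in>B. \<exists>l\<in>{0..1}. (\<Sum>b\<in>B. w b * f b) \<le> l * f b + (1 - l) * f b' \<and>
    (\<Sum>b\<in>B. w b * g b) \<le> l * g b + (1 - l) * g b'"
  using assms
proof (induction B arbitrary: w rule: finite_psubset_induct)
  case (psubset B)
  note w = psubset.prems
  have "B \<noteq> {}" using w(2) by auto
  show ?case
  proof (cases "3 \<le> card B")
    case False
    moreover have "card B \<noteq> 0" using \<open>B \<noteq> {}\<close> psubset.hyps by simp
    ultimately have "card B = 1 \<or> card B = 2" by linarith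
    then consider b where "B = {b}" | b b' where "B = {b, b'}" "b \<noteq> b'"
      by (auto simp: card_1_singleton_iff card_2_iff)
    then show ?thesis
    proof cases
      case 1
      then have "\<exists>l\<in>{0..1}. (\<Sum>b\<in>B. w b * f b) \<le> l * f b + (1 - l) * f b \<and>
          (\<Sum>b\<in>B. w b * g b) \<le> l * g b + (1 - l) * g b"
        using w by (intro bexI[of _ 1]) auto
      then show ?thesis using 1 by blast
    next
      case 2
      then have "w b' = 1 - w b" "w b \<in> {0..1}" using w(1)[of b] w(1)[of b'] w(2) by auto
      then have "\<exists>l\<in>{0..1}. (\<Sum>b\<in>B. w b * f b) \<le> l * f b + (1 - l) * f b' \<and>
          (\<Sum>b\<in>B. w b * g b) \<le> l * g b + (1 - l) * g b'"
        using 2 by (intro bexI[of _ "w b"]) simp_all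
      then show ?thesis using 2 by blast
    qed
  next
    case True
    obtain h where h: "(\<Sum>b\<in>B. h b) = 0" "(\<Sum>b\<in>B. h b * f b) = 0" "(\<Sum>b\<in>B. h b * g b) \<ge> 0"
      "\<exists>b\<in>B. h b < 0"
      by (rule exchange_direction[OF psubset.hyps True, of f g])
    define N where "N = {b \<in> B. h b < 0}"
    have N: "finite N" "N \<noteq> {}" using psubset.hyps h(4) by (auto simp: N_def)
    \<comment> \<open>The largest step along \<open>h\<close> that keeps all weights nonnegative; a
      minimizer \<open>c\<close> loses its entire weight.\<close>
    define t where "t = Min ((\<lambda>b. w b / - h b) ` N)"
    have "t \<in> (\<lambda>b. w b / - h b) ` N" unfolding t_def using N by (intro Min_in) auto
    then obtain c where c: "c \<in> N" "t = w c / - h c" by blast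
    have t: "t \<le> w b / - h b" if "b \<in> N" for b
      unfolding t_def using N that by (intro Min_le) auto
    have "t \<ge> 0" using c w(1) by (auto simp: N_def divide_nonneg_neg)
    define w' where "w' = (\<lambda>b. w b + t * h b)"
    have w'c: "w' c = 0" using c by (auto simp: w'_def N_def)
    have cB: "c \<in> B" using c by (simp add: N_def)
    have w'0: "0 \<le> w' b" if "b \<in> B" for b
    proof (cases "h b < 0")
      case True
      then have "t \<le> w b / - h b" using t that by (simp add: N_def)
      then have "t * - h b \<le> w b" using True by (subst (asm) pos_le_divide_eq) auto
      then show ?thesis by (simp add: w'_def)
    next
      case False
      then show ?thesis using w(1)[OF that] \<open>t \<ge> 0\<close> by (simp add: w'_def)
    qed
    have rem: "(\<Sum>b\<in>B - {c}. w' b * \<phi> b) = (\<Sum>b\<in>B. w b * \<phi> b) + t * (\<Sum>b\<in>B. h b * \<phi> b)" for \<phi>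
    proof -
      have "(\<Sum>b\<in>B - {c}. w' b * \<phi> b) = (\<Sum>b\<in>B. w' b * \<phi> b)"
        using psubset.hyps cB by (simp add: sum.remove w'c)
      then show ?thesis by (simp add: w'_def algebra_simps sum.distrib sum_distrib_left)
    qed
    have "\<exists>b\<in>B - {c}. \<exists>b'\<in>B - {c}. \<exists>l\<in>{0..1}.
      (\<Sum>b\<in>B - {c}. w' b * f b) \<le> l * f b + (1 - l) * f b' \<and>
      (\<Sum>b\<in>B - {c}. w' b * g b) \<le> l * g b + (1 - l) * g b'"
      using psubset.IH[of "B - {c}" w'] cB w'0 rem[of "\<lambda>_. 1"] h(1) w(2) by auto
    moreover have "(\<Sum>b\<in>B. w b * f b) \<le> (\<Sum>b\<in>B - {c}. w' b * f b)"
      "(\<Sum>b\<in>B. w b * g b) \<le> (\<Sum>b\<in>B - {c}. w' b * g b)"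
      using h \<open>t \<ge> 0\<close> unfolding rem by auto
    ultimately show ?thesis by (meson DiffD1 order_trans)
  qed
qed

section \<open>Payoffs of 2 x 2 subgames\<close>

text \<open>The weights \<open>p\<close> and \<open>q\<close> belong to \<open>a\<close> and
  \<open>b\<close>. Equal strategies \<open>a = a'\<close> or \<open>b = b'\<close> are allowed, so
  that pure strategies need no separate treatment.\<close>

definition subgame_payoff ::
  "('a \<times> 'b \<Rightarrow> real) \<Rightarrow> 'a \<Rightarrow> 'a \<Rightarrow> 'b \<Rightarrow> 'b \<Rightarrow> real \<Rightarrow> real \<Rightarrow> real" where
  "subgame_payoff u a a' b b' p q =
    p * (q * u (a, b) + (1 - q) * u (a, b')) + (1 - p) * (q * u (a', b) + (1 - q) * u (a', b'))"

lemma expected_payoff_nth: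
  "expected_payoff A1 A2 (payoff_vector u1 u2) \<sigma>1 \<sigma>2 $ 1 =
    (\<Sum>a\<in>A1. pmf \<sigma>1 a * (\<Sum>b\<in>A2. pmf \<sigma>2 b * u1 (a, b)))"
  "expected_payoff A1 A2 (payoff_vector u1 u2) \<sigma>1 \<sigma>2 $ 2 =
    (\<Sum>a\<in>A1. pmf \<sigma>1 a * (\<Sum>b\<in>A2. pmf \<sigma>2 b * u2 (a, b)))"
  by (simp_all add: expected_payoff_def payoff_vector_def sum_distrib_left mult.assoc)

text \<open>The image of a Bernoulli law also covers \<open>a = a'\<close>, where the two masses
  merge; expectations of arbitrary \<open>h\<close> avoid computing the masses.\<close>

lemma two_point_mixed_strategy:
  assumes "finite A" "a \<in> A" "a' \<in> A" "p \<in> {0..1}"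
  obtains \<sigma> where "\<sigma> \<in> mixed_strategies A"
    "\<And>h. (\<Sum>x\<in>A. pmf \<sigma> x * h x) = p * h a + (1 - p) * h a'"
proof
  define \<sigma> where "\<sigma> = map_pmf (\<lambda>c. if c then a else a') (bernoulli_pmf p)"
  have set: "set_pmf \<sigma> \<subseteq> A" using assms by (auto simp: \<sigma>_def)
  then show "\<sigma> \<in> mixed_strategies A" by (simp add: mixed_strategies_def)
  fix h :: "'a \<Rightarrow> real"
  have "(\<Sum>x\<in>A. pmf \<sigma> x * h x) = (LINT x|\<sigma>. h x)"
    using set by (subst integral_measure_pmf[OF assms(1)]) auto
  also have "\<dots> = p * h a + (1 - p) * h a'" using assms(4) by (simp add: \<sigma>_def)
  finally show "(\<Sum>x\<in>A. pmf \<sigma> x * h x) = p * h a + (1 - p) * h a'" .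
qed

lemma subgame_payoff_in_region:
  assumes "finite A1" "finite A2" "a \<in> A1" "a' \<in> A1" "b \<in> A2" "b' \<in> A2" "p \<in> {0..1}" "q \<in> {0..1}"
  obtains w where "w \<in> noncoop_payoff_region A1 A2 u1 u2"
    "w $ 1 = subgame_payoff u1 a a' b b' p q" "w $ 2 = subgame_payoff u2 a a' b b' p q"
proof -
  obtain \<sigma>1 where 1: "\<sigma>1 \<in> mixed_strategies A1"
    "\<And>h. (\<Sum>x\<in>A1. pmf \<sigma>1 x * h x) = p * h a + (1 - p) * h a'"
    using two_point_mixed_strategy[OF assms(1,3,4,7)] by blast
  obtain \<sigma>2 where 2: "\<sigma>2 \<in> mixed_strategies A2"
    "\<And>h. (\<Sum>x\<in>A2. pmf \<sigma>2 x * h x) = q * h b + (1 - q) * h b'"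
    using two_point_mixed_strategy[OF assms(2,5,6,8)] by blast
  show thesis
  proof
    show "expected_payoff A1 A2 (payoff_vector u1 u2) \<sigma>1 \<sigma>2 \<in> noncoop_payoff_region A1 A2 u1 u2"
      using 1 2 by (auto simp: noncoop_payoff_region_def)
  qed (simp_all add: expected_payoff_nth 1 2 subgame_payoff_def)
qed

text \<open>The reduction to two points is applied twice: first to player 2 against the fixed
  \<open>\<sigma>1\<close>, then to player 1 against the resulting two-point strategy. Payoffs are
  linear in each strategy separately, and the two dominations compose.\<close>

lemma region_le_subgame_payoff:
  fixes A1 :: "'a set" and A2 :: "'b set"
  assumes "finite A1" "finite A2" "v \<in> noncoop_payoff_region A1 A2 u1 u2"
  obtains a a' b b' p q where "a \<in> A1" "a' \<in> A1" "b \<in> A2" "b' \<in> A2" "p \<in> {0..1}" "q \<in> {0..1}"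
    "v $ 1 \<le> subgame_payoff u1 a a' b b' p q" "v $ 2 \<le> subgame_payoff u2 a a' b b' p q"
proof -
  obtain \<sigma>1 \<sigma>2 where \<sigma>: "set_pmf \<sigma>1 \<subseteq> A1" "set_pmf \<sigma>2 \<subseteq> A2"
    and v: "v = expected_payoff A1 A2 (payoff_vector u1 u2) \<sigma>1 \<sigma>2"
    using assms(3) by (auto simp: noncoop_payoff_region_def mixed_strategies_def)
  \<comment> \<open>The payoff of the pure strategy \<open>b\<close> against
    \<open>\<sigma>1\<close>; below, \<open>F2\<close> is that of pure \<open>a\<close> against the
    mixture of \<open>b\<close> and \<open>b'\<close>.\<close>
  define F1 where "F1 = (\<lambda>(u :: 'a \<times> 'b \<Rightarrow> real) b. \<Sum>a\<in>A1. pmf \<sigma>1 a * u (a, b))"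
  have swap: "(\<Sum>a\<in>A1. pmf \<sigma>1 a * (\<Sum>b\<in>A2. pmf \<sigma>2 b * u (a, b))) = (\<Sum>b\<in>A2. pmf \<sigma>2 b * F1 u b)"
    for u :: "'a \<times> 'b \<Rightarrow> real"
    unfolding F1_def sum_distrib_left by (subst sum.swap) (simp add: mult_ac)
  obtain b b' q where b: "b \<in> A2" "b' \<in> A2" "q \<in> {0..1}"
    "v $ 1 \<le> q * F1 u1 b + (1 - q) * F1 u1 b'" "v $ 2 \<le> q * F1 u2 b + (1 - q) * F1 u2 b'"
    using convex_combination_le_pair[OF assms(2), of "pmf \<sigma>2" "F1 u1" "F1 u2"]
      sum_pmf_eq_1[OF assms(2) \<sigma>(2)]
    unfolding v expected_payoff_nth swap by auto
  define F2 where "F2 = (\<lambda>(u :: 'a \<times> 'b \<Rightarrow> real) a. q * u (a, b) + (1 - q) * u (a, b'))"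
  have F2: "q * F1 u b + (1 - q) * F1 u b' = (\<Sum>a\<in>A1. pmf \<sigma>1 a * F2 u a)" for u
    unfolding F1_def F2_def sum_distrib_left sum.distrib[symmetric]
    by (intro sum.cong) (auto simp: algebra_simps)
  obtain a a' p where "a \<in> A1" "a' \<in> A1" "p \<in> {0..1}"
    "v $ 1 \<le> p * F2 u1 a + (1 - p) * F2 u1 a'" "v $ 2 \<le> p * F2 u2 a + (1 - p) * F2 u2 a'"
    using convex_combination_le_pair[OF assms(1), of "pmf \<sigma>1" "F2 u1" "F2 u2"]
      sum_pmf_eq_1[OF assms(1) \<sigma>(1)] b(4,5)
    unfolding F2 by (auto intro: order_trans)
  then show thesis using that[of a a' b b' p q] b by (simp add: F2_def subgame_payoff_def)
qed

section \<open>Clustering of subgame strategies and the slope bound\<close>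

theorem theorem5p2:
  fixes A1 :: "'a set" and A2 :: "'b set"
    and u1 u2 :: "'a \<times> 'b \<Rightarrow> real"
    and v :: "nat \<Rightarrow> real ^ 2" and vstar :: "real ^ 2"
  assumes "finite A1" and "A1 \<noteq> {}" and "finite A2" and "A2 \<noteq> {}"
    and "\<And>t. v t \<in> noncoop_payoff_region A1 A2 u1 u2"
    and "vstar \<in> noncoop_payoff_region A1 A2 u1 u2"
    and "v \<longlonglongrightarrow> vstar"
    and "\<And>t. v t $ 1 > vstar $ 1"
    and "\<And>t. vstar $ 2 > v t $ 2"
    and "(\<lambda>t. (v t $ 2 - vstar $ 2) / (v t $ 1 - vstar $ 1)) \<longlonglongrightarrow> 0"
  shows "vstar \<notin> pareto_frontier (noncoop_payoff_region A1 A2 u1 u2)"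
proof
  assume "vstar \<in> pareto_frontier (noncoop_payoff_region A1 A2 u1 u2)"
  then have nodom: "w = vstar" if "w \<in> noncoop_payoff_region A1 A2 u1 u2"
    "vstar $ 1 \<le> w $ 1" "vstar $ 2 \<le> w $ 2" for w
    using that by (auto simp: pareto_frontier_def pareto_dominates_def forall_2)
  define T where "T = A1 \<times> A1 \<times> A2 \<times> A2"
  define pay where "pay = (\<lambda>u (c :: 'a \<times> 'a \<times> 'b \<times> 'b) (x :: real \<times> real).
    case c of (a, a', b, b') \<Rightarrow> subgame_payoff u a a' b b' (fst x) (snd x))"
  have "\<exists>c x. c \<in> T \<and> x \<in> {0..1} \<times> {0..1} \<and> v t $ 1 \<le> pay u1 c x \<and> v t $ 2 \<le> pay u2 c x" for t
  proof -
    obtain a a' b b' p q where "a \<in> A1" "a' \<in> A1" "b \<in> A2" "b' \<in> A2" "p \<in> {0..1}" "q \<in> {0..1}"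
      "v t $ 1 \<le> subgame_payoff u1 a a' b b' p q" "v t $ 2 \<le> subgame_payoff u2 a a' b b' p q"
      by (rule region_le_subgame_payoff[OF assms(1,3,5), of t])
    then show ?thesis
      by (intro exI[of _ "(a, a', b, b')"] exI[of _ "(p, q)"]) (simp add: T_def pay_def)
  qed
  then obtain c x where cx: "\<And>t. c t \<in> T" "\<And>t. x t \<in> {0..1} \<times> {0..1}"
    "\<And>t. v t $ 1 \<le> pay u1 (c t) (x t)" "\<And>t. v t $ 2 \<le> pay u2 (c t) (x t)"
    by metis
  have "finite T" using assms(1,3) by (simp add: T_def)
  then have "finite (range c)" using cx(1) by (meson finite_subset image_subsetI)
  \<comment> \<open>Only finitely many subgames exist, so one of them dominates \<open>v t\<close>
    for infinitely many \<open>t\<close>.\<close>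
  then obtain t0 where inf: "infinite {t. c t = c t0}"
    using pigeonhole_infinite[of "UNIV :: nat set" c] by auto
  obtain a a' b b' where ab: "c t0 = (a, a', b, b')" by (rule prod_cases4)
  obtain r :: "nat \<Rightarrow> nat" where r: "strict_mono r" "\<And>n. c (r n) = (a, a', b, b')"
    using infinite_enumerate[OF inf] ab by auto
  have T: "a \<in> A1" "a' \<in> A1" "b \<in> A2" "b' \<in> A2" using cx(1)[of t0] by (simp_all add: ab T_def)
  define f g where "f = subgame_payoff u1 a a' b b'" and "g = subgame_payoff u2 a a' b b'"
  define z where "z = (\<lambda>n. x (r n))"
  have z: "z n \<in> {0..1} \<times> {0..1}" "v (r n) $ 1 \<le> f (fst (z n)) (snd (z n))"
    "v (r n) $ 2 \<le> g (fst (z n)) (snd (z n))" for n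
    using cx(2-4)[of "r n"] by (simp_all add: r(2) z_def f_def g_def pay_def)
  have "compact ({0..1::real} \<times> {0..1::real})" by (intro compact_Times compact_Icc)
  then obtain l r' where l: "l \<in> {0..1} \<times> {0..1}" "strict_mono r'" "(z \<circ> r') \<longlonglongrightarrow> l"
    using z unfolding compact_def by metis
  obtain p q where pq: "l = (p, q)" by (cases l)
  define P Q where "P = (\<lambda>n. fst (z (r' n)))" and "Q = (\<lambda>n. snd (z (r' n)))"
  define V where "V = (\<lambda>n. v (r (r' n)))"
  have sub: "strict_mono (r \<circ> r')" using r l by (intro strict_mono_o)
  have P: "P \<longlonglongrightarrow> p" and Q: "Q \<longlonglongrightarrow> q"
    using tendsto_fst[OF l(3)] tendsto_snd[OF l(3)] by (auto simp: P_def Q_def pq o_def)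
  have V: "V \<longlonglongrightarrow> vstar"
    using LIMSEQ_subseq_LIMSEQ[OF assms(7) sub] by (simp add: V_def o_def)
  have PQ: "P n \<in> {0..1}" "Q n \<in> {0..1}" "V n $ 1 \<le> f (P n) (Q n)" "V n $ 2 \<le> g (P n) (Q n)" for n
    using z[of "r' n"] by (auto simp: P_def Q_def V_def mem_Times_iff)
  have pq01: "p \<in> {0..1}" "q \<in> {0..1}" using l pq by auto
  have realized: "\<exists>w\<in>noncoop_payoff_region A1 A2 u1 u2. w $ 1 = f p' q' \<and> w $ 2 = g p' q'"
    if "p' \<in> {0..1}" "q' \<in> {0..1}" for p' q'
    using subgame_payoff_in_region[OF assms(1,3) T that, of u1 u2] unfolding f_def g_def by metis
  have "(\<lambda>n. f (P n) (Q n)) \<longlonglongrightarrow> f p q" "(\<lambda>n. g (P n) (Q n)) \<longlonglongrightarrow> g p q"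
    unfolding f_def g_def subgame_payoff_def by (intro tendsto_intros P Q)+
  then have "vstar $ 1 \<le> f p q" "vstar $ 2 \<le> g p q"
    using LIMSEQ_le[OF tendsto_vec_nth[OF V]] PQ(3,4) by blast+
  then have star: "f p q = vstar $ 1" "g p q = vstar $ 2"
    using realized[OF pq01] nodom by metis+
  \<comment> \<open>Subgame payoffs lie in the region, so optimality of \<open>vstar\<close> there
    passes to \<open>(p, q)\<close> in the square.\<close>
  have pareto: "f p' q' = f p q \<and> g p' q' = g p q"
    if "p' \<in> {0..1}" "q' \<in> {0..1}" "f p q \<le> f p' q'" "g p q \<le> g p' q'" for p' q'
    using realized[OF that(1,2)] nodom that(3,4) unfolding star by metis
  have bilinear: "subgame_payoff u a a' b b' p' q' = u (a', b') + (u (a, b') - u (a', b')) * p'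
    + (u (a', b) - u (a', b')) * q' + (u (a, b) - u (a, b') - u (a', b) + u (a', b')) * p' * q'"
    for u :: "'a \<times> 'b \<Rightarrow> real" and p' q'
    by (simp add: subgame_payoff_def algebra_simps)
  obtain k e where ke: "k > 0" "e > 0"
    "\<And>p' q'. \<lbrakk>p' \<in> {0..1}; q' \<in> {0..1}; \<bar>p' - p\<bar> < e; \<bar>q' - q\<bar> < e; f p q \<le> f p' q'\<rbrakk>
      \<Longrightarrow> k * (f p' q' - f p q) + (g p' q' - g p q) \<le> 0"
    using bilinear_pareto_multiplier_square
      [OF bilinear[of u1, folded f_def] bilinear[of u2, folded g_def] pareto pq01] by blast
  have slope: "(\<lambda>n. (V n $ 2 - vstar $ 2) / (V n $ 1 - vstar $ 1)) \<longlonglongrightarrow> 0"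
    using LIMSEQ_subseq_LIMSEQ[OF assms(10) sub] by (simp add: V_def o_def)
  have "eventually (\<lambda>n. (V n $ 2 - vstar $ 2) / (V n $ 1 - vstar $ 1) > - k) sequentially"
    using slope ke(1) by (intro order_tendstoD) auto
  moreover have "eventually (\<lambda>n. \<bar>P n - p\<bar> < e) sequentially"
    "eventually (\<lambda>n. \<bar>Q n - q\<bar> < e) sequentially"
    using P Q ke(2) by (auto simp: tendsto_iff dist_real_def)
  \<comment> \<open>Since \<open>V n\<close> lies strictly to the right of \<open>vstar\<close>, so
    does the subgame payoff dominating it, and the multiplier inequality applies. Passing back to
    \<open>V n\<close> lowers both coordinates and bounds its slope by \<open>- k\<close>, against
    the limit 0.\<close>
  ultimately have "eventually (\<lambda>n. False) sequentially"
  proof eventually_elim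
    case (elim n)
    have pos: "V n $ 1 > vstar $ 1" using assms(8) by (simp add: V_def)
    then have "k * (V n $ 1 - vstar $ 1) \<le> k * (f (P n) (Q n) - f p q)"
      using PQ(3)[of n] ke(1) star by (intro mult_left_mono) auto
    also have "\<dots> \<le> - (g (P n) (Q n) - g p q)"
      using ke(3)[OF PQ(1,2) elim(2,3)] PQ(3)[of n] pos star by force
    also have "\<dots> \<le> - (V n $ 2 - vstar $ 2)" using PQ(4)[of n] star by simp
    finally show False using elim(1) pos by (simp add: pos_less_divide_eq)
  qed
  then show False by simp
qed

end
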